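(* Let $V_0,V_1,\dots$ be indeterminates and let $\mathbf{b}=(b_i)_{i\ge0}$, $\boldsymbol{\lambda}=(\lambda_i)_{i\ge1}$ be given by $b_i=-V_i^{-1}$ and $\lambda_i=V_i^{-1}V_{i-1}^{-1}$. Then for all integers $k\ge1$ and $n\ge1$, \[ \mu^{\le 3k}_{-n}(\mathbf{b},\boldsymbol{\lambda})=(-1)^nV_0\sum_{\pi\in\widetilde{\mathrm{PV}}^{3,3k}_{n-1}}\mathrm{wt}(\pi). \]
   Context: A Motzkin path is a finite sequence of points in $\mathbb{Z}\times\mathbb{Z}_{\ge0}$ whose steps are each $(1,1)$, $(1,0)$ or $(1,-1)$; its weight is the product of $b_i$ over horizontal steps starting at height $i$ and $\lambda_i$ over down steps starting at height $i$. $\mu^{\le K}_N(\mathbf{b},\boldsymbol{\lambda})$ ($N\ge0$) is the sum of weights of Motzkin paths from $(0,0)$ to $(N,0)$ staying weakly below $y=K$. If $(f_N)_{N\ge0}$ satisfies $f_N=c_1f_{N-1}+\cdots+c_df_{N-d}$ for all $N\ge d$ with $c_d\ne0$, it is extended uniquely to all $N\in\mathbb{Z}$ so the recurrence holds for all $N$; $\mu^{\le K}_{-N}$ denotes this extension (it exists here). $\mathrm{wt}((a_1,\dots,a_N))=V_{a_1}\cdots V_{a_N}$ (empty sequence: $1$). A modified $3$-peak-valley sequence is a sequence $(a_1,\dots,a_N)$ of nonnegative integers such that, with $a_0=a_{N+1}=0$, each $a_i\equiv1\pmod3$ satisfies $a_{i-1}>a_i<a_{i+1}$ and each $a_i\equiv2\pmod3$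 satisfies $a_{i-1}<a_i>a_{i+1}$ ($1\le i\le N$); $\widetilde{\mathrm{PV}}^{3,K}_N$ is the set of those of length $N$ with entries in $\{0,\dots,K\}$ ($\widetilde{\mathrm{PV}}^{3,K}_0$ is the set containing the empty sequence). *)

theory Defs
  imports "HOL-Library.Poly_Mapping" "HOL-Computational_Algebra.Fraction_Field"
begin

text \<open>Monomials are finitely supported exponent vectors, so the type below is the field of
  rational functions over the coefficient domain in countably many indeterminates.\<close>

type_synonym 'a ratfun = "((nat \<Rightarrow>\<^sub>0 nat) \<Rightarrow>\<^sub>0 'a) fract"

definition indet :: "nat \<Rightarrow> 'a::idom ratfun" where
  "indet i = Fract (Poly_Mapping.single (Poly_Mapping.single i 1) 1) 1"

text \<open>The second coordinate is a natural number, so a path never goes below the horizontal axis.\<close>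

definition motzkin_path :: "(int \<times> nat) list \<Rightarrow> bool" where
  "motzkin_path p \<longleftrightarrow> p \<noteq> [] \<and>
     (\<forall>j. Suc j < length p \<longrightarrow>
        fst (p ! Suc j) = fst (p ! j) + 1 \<and>
        int (snd (p ! Suc j)) - int (snd (p ! j)) \<in> {1, 0, -1})"

definition step_weight ::
  "(nat \<Rightarrow> 'f) \<Rightarrow> (nat \<Rightarrow> 'f) \<Rightarrow> int \<times> nat \<Rightarrow> int \<times> nat \<Rightarrow> 'f::field" where
  "step_weight b lam u v =
     (if snd v = snd u then b (snd u) else if snd v < snd u then lam (snd u) else 1)"

definition path_weight :: "(nat \<Rightarrow> 'f) \<Rightarrow> (nat \<Rightarrow> 'f) \<Rightarrow> (int \<times> nat) list \<Rightarrow> 'f::field" where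
  "path_weight b lam p = (\<Prod>j<length p - 1. step_weight b lam (p ! j) (p ! Suc j))"

definition motzkin_paths :: "nat \<Rightarrow> nat \<Rightarrow> (int \<times> nat) list set" where
  "motzkin_paths K N = {p. motzkin_path p \<and> hd p = (0, 0) \<and> last p = (int N, 0) \<and>
     (\<forall>u\<in>set p. snd u \<le> K)}"

definition mu :: "nat \<Rightarrow> (nat \<Rightarrow> 'f) \<Rightarrow> (nat \<Rightarrow> 'f) \<Rightarrow> nat \<Rightarrow> 'f::field" where
  "mu K b lam N = (\<Sum>p\<in>motzkin_paths K N. path_weight b lam p)"

lemma motzkin_path_fst:
  assumes "motzkin_path p" "hd p = (0, 0)" "j < length p"
  shows "fst (p ! j) = int j"
  using assms(3)
proof (induction j)
  case 0
  then show ?case using assms(2) by (cases p) auto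
next
  case (Suc j)
  then show ?case using assms(1) by (auto simp: motzkin_path_def)
qed

lemma finite_motzkin_paths: "finite (motzkin_paths K N)"
proof (rule finite_subset)
  show "motzkin_paths K N \<subseteq> {p. set p \<subseteq> {0..int N} \<times> {..K} \<and> length p = Suc N}"
  proof (rule subsetI, rule CollectI, rule conjI)
    fix p assume "p \<in> motzkin_paths K N"
    then have p: "motzkin_path p" "hd p = (0, 0)" "last p = (int N, 0)"
        "\<forall>u\<in>set p. snd u \<le> K" "p \<noteq> []"
      by (auto simp: motzkin_paths_def motzkin_path_def)
    have "fst (p ! (length p - 1)) = int (length p - 1)"
      using p by (intro motzkin_path_fst) auto
    then show len: "length p = Suc N"
      using p by (cases "length p") (auto simp: last_conv_nth)
    show "set p \<subseteq> {0..int N} \<times> {..K}"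
    proof
      fix u assume u: "u \<in> set p"
      then obtain j where j: "j < length p" "u = p ! j" by (auto simp: in_set_conv_nth)
      have "fst u = int j" using motzkin_path_fst p j by auto
      then show "u \<in> {0..int N} \<times> {..K}"
        using p(4) u j(1) len by (cases u) auto
    qed
  qed
  show "finite {p. set p \<subseteq> {0..int N} \<times> {..K} \<and> length p = Suc N}"
    by (rule finite_lists_length_eq) simp
qed

definition rec_extension :: "(nat \<Rightarrow> 'f::field) \<Rightarrow> (int \<Rightarrow> 'f) \<Rightarrow> bool" where
  "rec_extension f g \<longleftrightarrow>
     (\<forall>N. g (int N) = f N) \<and>
     (\<exists>d c. d \<ge> 1 \<and> c d \<noteq> 0 \<and>
        (\<forall>N\<ge>d. f N = (\<Sum>i=1..d. c i * f (N - i))) \<and>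
        (\<forall>N. g N = (\<Sum>i=1..d. c i * g (N - int i))))"

lemma rec_zero:
  fixes r :: "int \<Rightarrow> 'f::field"
  assumes d: "d \<ge> 1" "c d \<noteq> 0"
    and rec: "\<And>N. r N = (\<Sum>i=1..d. c i * r (N - int i))"
    and zero: "\<And>N. N \<ge> m \<Longrightarrow> r N = 0"
  shows "r N = 0"
proof -
  have "r (m - int j) = 0" for j
  proof (induction j rule: less_induct)
    case (less j)
    have small: "r N = 0" if "N > m - int j" for N
    proof (cases "N \<ge> m")
      case False
      then have "N = m - int (nat (m - N))" "nat (m - N) < j" using that by auto
      then show ?thesis using less by metis
    qed (simp add: zero)
    have "r (m - int j + int d) = (\<Sum>i=1..d. c i * r (m - int j + int d - int i))"
      by (rule rec)
    also have "\<dots> = (\<Sum>i\<in>{d}. c i * r (m - int j + int d - int i))"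
      using d by (intro sum.mono_neutral_right) (auto intro!: small)
    finally have "c d * r (m - int j) = r (m - int j + int d)" by simp
    also have "\<dots> = 0" using d by (intro small) auto
    finally show ?case using d by simp
  qed
  from this[of "nat (m - N)"] show ?thesis
    by (cases "N \<ge> m") (auto simp: zero)
qed

text \<open>The extension depends neither on the order nor on the coefficients of the recurrence.\<close>

lemma rec_extension_unique:
  fixes g h :: "int \<Rightarrow> 'f::field"
  assumes "rec_extension f g" "rec_extension f h"
  shows "g = h"
proof -
  obtain d c where 1: "d \<ge> 1" "c d \<noteq> 0" "\<And>N. g N = (\<Sum>i=1..d. c i * g (N - int i))"
    using assms(1) unfolding rec_extension_def by blast
  obtain e c' where 2: "e \<ge> 1" "c' e \<noteq> 0" "\<And>N. h N = (\<Sum>i=1..e. c' i * h (N - int i))"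
    using assms(2) unfolding rec_extension_def by blast
  have agree: "g N = h N" if "N \<ge> 0" for N
    using assms that unfolding rec_extension_def by (metis nonneg_int_cases)
  define r where "r N = g N - (\<Sum>k=1..e. c' k * g (N - int k))" for N
  have r0: "r N = 0" for N
  proof (rule rec_zero[where r = r and d = d and c = c and m = "int e", OF 1(1,2)])
    show "r N = (\<Sum>i=1..d. c i * r (N - int i))" for N
    proof -
      have "(\<Sum>k=1..e. c' k * g (N - int k))
          = (\<Sum>k=1..e. \<Sum>i=1..d. c i * (c' k * g (N - int i - int k)))"
      proof (rule sum.cong[OF refl])
        fix k
        have "c' k * g (N - int k) = c' k * (\<Sum>i=1..d. c i * g (N - int k - int i))"
          by (subst 1(3)) simp
        then show "c' k * g (N - int k) = (\<Sum>i=1..d. c i * (c' k * g (N - int i - int k)))"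
          by (simp add: sum_distrib_left algebra_simps)
      qed
      also have "\<dots> = (\<Sum>i=1..d. c i * (\<Sum>k=1..e. c' k * g (N - int i - int k)))"
        by (subst sum.swap) (simp add: sum_distrib_left)
      finally show ?thesis
        unfolding r_def using 1(3)[of N] by (simp add: right_diff_distrib sum_subtractf)
    qed
    show "r N = 0" if "N \<ge> int e" for N
    proof -
      have "(\<Sum>k=1..e. c' k * g (N - int k)) = (\<Sum>k=1..e. c' k * h (N - int k))"
        using that by (intro sum.cong) (auto simp: agree)
      then show ?thesis using 2(3)[of N] agree[of N] that by (simp add: r_def)
    qed
  qed
  have "g N - h N = 0" for N
  proof (rule rec_zero[where r = "\<lambda>N. g N - h N" and d = e and c = c' and m = 0, OF 2(1,2)])
    show "g N - h N = (\<Sum>i=1..e. c' i * (g (N - int i) - h (N - int i)))" for N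
      using r0[of N] 2(3)[of N] by (simp add: r_def right_diff_distrib sum_subtractf)
  qed (simp add: agree)
  then show ?thesis by auto
qed

definition rec_ext :: "(nat \<Rightarrow> 'f::field) \<Rightarrow> int \<Rightarrow> 'f" where
  "rec_ext f = (THE g. rec_extension f g)"

lemma rec_ext_eq: "rec_extension f g \<Longrightarrow> rec_ext f = g"
  unfolding rec_ext_def by (blast intro: rec_extension_unique)

text \<open>The list is padded by a zero at both ends, so that position \<open>i\<close> holds \<open>a\<^sub>i\<close>.\<close>

definition modified_pv3 :: "nat list \<Rightarrow> bool" where
  "modified_pv3 xs \<longleftrightarrow> (let a = (\<lambda>i. (0 # xs @ [0]) ! i) in
     \<forall>i\<in>{1..length xs}.
       (a i mod 3 = 1 \<longrightarrow> a (i - 1) > a i \<and> a i < a (i + 1)) \<and>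
       (a i mod 3 = 2 \<longrightarrow> a (i - 1) < a i \<and> a i > a (i + 1)))"

definition modified_PV3 :: "nat \<Rightarrow> nat \<Rightarrow> nat list set" where
  "modified_PV3 K N = {xs. length xs = N \<and> set xs \<subseteq> {0..K} \<and> modified_pv3 xs}"

definition seq_wt :: "nat list \<Rightarrow> 'a::idom ratfun" where
  "seq_wt xs = prod_list (map indet xs)"

lemma finite_modified_PV3: "finite (modified_PV3 K N)"
  by (rule finite_subset[OF _ finite_lists_length_eq[of "{0..K}" N]])
    (auto simp: modified_PV3_def)

end

theory Submission
  imports Defs
begin

text \<open>
  Weights of paths from \<open>(0, 0)\<close> to \<open>(N, i)\<close> are iterates of a tridiagonal matrix of size
  \<open>3k + 1\<close>, which a diagonal conjugation turns into \<open>diag(V)\<^sup>-\<^sup>1 M\<close>, where \<open>M\<close> has entries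
  \<open>-1\<close> on the diagonal and \<open>1\<close> next to it.  The leading minors of \<open>M\<close>
  repeat \<open>1, -1, 0\<close>, so that \<open>det M = -1\<close>; explicitly,
  \<open>M\<^sup>-\<^sup>1 = - D E D\<close> with \<open>D\<close> a diagonal of signs and \<open>E\<close> the 0-1 matrix of pairs that may be
  adjacent in a modified 3-peak-valley sequence.  Hence powers of the inverse matrix enumerate
  these sequences.  Since the matrix is invertible, a linear dependence among sufficiently many
  consecutive iterates is a recurrence valid on all integers.
\<close>

section \<open>Linear dependence and two-sided recurrences for orbits of a linear map\<close>

text \<open>Gaussian elimination: induction on the number \<open>m\<close> of equations, where the
  last equation is solved for one pivot unknown.\<close>

lemma homogeneous_system_nontrivial:
  fixes v :: "'b \<Rightarrow> nat \<Rightarrow> 'f::field"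
  assumes "finite J" "card J > m"
  shows "\<exists>a. (\<exists>j\<in>J. a j \<noteq> 0) \<and> (\<forall>i<m. (\<Sum>j\<in>J. a j * v j i) = 0)"
  using assms
proof (induction m arbitrary: J v)
  case 0
  then have "J \<noteq> {}" by auto
  then show ?case by (intro exI[of _ "\<lambda>_. 1"]) auto
next
  case (Suc m)
  show ?case
  proof (cases "\<forall>j\<in>J. v j m = 0")
    case True
    obtain a where "\<exists>j\<in>J. a j \<noteq> 0" "\<forall>i<m. (\<Sum>j\<in>J. a j * v j i) = 0"
      using Suc.IH[of J v] Suc.prems by auto
    then show ?thesis using True by (intro exI[of _ a]) (auto simp: less_Suc_eq)
  next
    case False
    then obtain p where p: "p \<in> J" "v p m \<noteq> 0" by blast
    \<comment> \<open>Subtracting multiples of the pivot vector \<open>v p\<close> clears coordinate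
      \<open>m\<close>, so that the first \<open>m\<close> equations in the unknowns other than
      \<open>p\<close> remain.\<close>
    define w where "w j i = v j i - v j m / v p m * v p i" for j i
    obtain a where a: "\<exists>j\<in>J - {p}. a j \<noteq> 0"
        "\<And>i. i < m \<Longrightarrow> (\<Sum>j\<in>J - {p}. a j * w j i) = 0"
    proof -
      have "card (J - {p}) > m" using Suc.prems p(1) by simp
      then show ?thesis using Suc.IH[of "J - {p}" w] Suc.prems(1) that by blast
    qed
    \<comment> \<open>The value of the unknown \<open>p\<close> that equation \<open>m\<close>
      forces.\<close>
    define s where "s = - (\<Sum>j\<in>J - {p}. a j * v j m / v p m)"
    have "(\<Sum>j\<in>J. (a(p := s)) j * v j i) = 0" if "i < Suc m" for i
    proof -
      have "(\<Sum>j\<in>J. (a(p := s)) j * v j i) = s * v p i + (\<Sum>j\<in>J - {p}. a j * v j i)"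
        using Suc.prems(1) p(1) by (simp add: sum.remove)
      also have "\<dots> = (\<Sum>j\<in>J - {p}. a j * w j i)"
        by (simp add: s_def w_def sum_distrib_right right_diff_distrib sum_subtractf mult.assoc)
      also have "\<dots> = 0"
        using a(2)[of i] that p(2) by (cases "i = m") (auto simp: w_def)
      finally show ?thesis .
    qed
    moreover have "\<exists>j\<in>J. (a(p := s)) j \<noteq> 0" using a(1) by auto
    ultimately show ?thesis by blast
  qed
qed

text \<open>Among \<open>m + 1\<close> consecutive vectors of an \<open>m\<close>-dimensional space
  there is a linear relation. Applying \<open>T\<close> shifts it forward, injectivity of
  \<open>T\<close> shifts it backward, so it holds at every integer position.\<close>

lemma linear_orbit_recurrence:
  fixes v :: "int \<Rightarrow> nat \<Rightarrow> 'f::field" and T :: "(nat \<Rightarrow> 'f) \<Rightarrow> nat \<Rightarrow> 'f"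
  assumes step: "\<And>N. v (N + 1) = T (v N)"
    and supp: "\<And>N i. i \<ge> m \<Longrightarrow> v N i = 0"
    and lin: "\<And>(J :: nat set) a w. finite J \<Longrightarrow>
      T (\<lambda>i. \<Sum>j\<in>J. a j * w j i) = (\<lambda>i. \<Sum>j\<in>J. a j * T (w j) i)"
    and inj: "\<And>w. (\<And>i. i \<ge> m \<Longrightarrow> w i = 0) \<Longrightarrow> T w = (\<lambda>_. 0) \<Longrightarrow> w = (\<lambda>_. 0)"
    and nz: "v 0 \<noteq> (\<lambda>_. 0)"
  shows "\<exists>d c. d \<ge> 1 \<and> c d \<noteq> 0 \<and> (\<forall>N i. v N i = (\<Sum>l=1..d. c l * v (N - int l) i))"
proof -
  obtain a where a: "\<exists>j\<le>m. a j \<noteq> 0" "\<And>i. i < m \<Longrightarrow> (\<Sum>j\<le>m. a j * v (int j) i) = 0"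
    using homogeneous_system_nontrivial[of "{..m}" m "\<lambda>j. v (int j)"] by auto
  \<comment> \<open>The relation moved to start at position \<open>N\<close>.\<close>
  define comb where "comb N = (\<lambda>i. \<Sum>j\<le>m. a j * v (N + int j) i)" for N
  have T0: "T (\<lambda>_. 0) = (\<lambda>_. 0)"
    using lin[of "{}"] by simp
  have comb_step: "comb (N + 1) = T (comb N)" for N
    unfolding comb_def
    by (subst lin) (simp_all add: step[symmetric] ac_simps)
  have comb0: "comb N = (\<lambda>_. 0)" for N
  proof (induction N rule: int_induct[where k = 0])
    case base
    show ?case
    proof
      fix i show "comb 0 i = 0" using a(2)[of i] supp by (cases "i < m") (auto simp: comb_def)
    qed
  next
    case (step1 N)
    then show ?case by (simp add: comb_step T0)
  next
    \<comment> \<open>Backward shift: \<open>T\<close> maps \<open>comb (N - 1)\<close> to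
      \<open>comb N\<close>, which is zero.\<close>
    case (step2 N)
    show ?case
    proof (rule inj)
      show "comb (N - 1) i = 0" if "i \<ge> m" for i using supp that by (simp add: comb_def)
      show "T (comb (N - 1)) = (\<lambda>_. 0)" using comb_step[of "N - 1"] step2 by simp
    qed
  qed
  have v_nz: "v N \<noteq> (\<lambda>_. 0)" for N
  proof (induction N rule: int_induct[where k = 0])
    case (step1 N)
    then show ?case using inj[of "v N", OF supp] by (simp add: step) blast
  next
    case (step2 N)
    then show ?case using step[of "N - 1"] T0 by auto
  qed (rule nz)
  define S where "S = {j. j \<le> m \<and> a j \<noteq> 0}"
  \<comment> \<open>Trimming to the first and last nonzero coefficients: \<open>a q\<close> can be
    divided by, and \<open>a p\<close> becomes the nonzero coefficient of highest order
    \<open>d = q - p\<close>.\<close>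
  define p q where "p = Min S" and "q = Max S"
  have S: "finite S" "S \<noteq> {}" using a(1) by (auto simp: S_def)
  then have pq: "p \<in> S" "q \<in> S" by (auto simp: p_def q_def)
  have S_sub: "S \<subseteq> {p..q}" using S by (auto simp: p_def q_def)
  have restrict: "(\<Sum>j=p..q. a j * v (N + int j) i) = 0" for N i
  proof -
    have "(\<Sum>j=p..q. a j * v (N + int j) i) = comb N i"
      unfolding comb_def using S_sub pq
      by (intro sum.mono_neutral_left) (auto simp: S_def)
    then show ?thesis by (simp add: comb0)
  qed
  have "p \<le> q" using pq S_sub by auto
  have "p \<noteq> q"
  proof
    assume "p = q"
    then have "a q * v (- int q + int q) i = 0" for i
      using restrict[of "- int q" i] by simp
    then have "v 0 = (\<lambda>_. 0)" using pq by (auto simp: S_def)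
    then show False using nz by contradiction
  qed
  with \<open>p \<le> q\<close> have "p < q" by simp
  have "v N i = (\<Sum>l=1..q - p. - (a (q - l) / a q) * v (N - int l) i)" for N i
  proof -
    have "{p..q} = insert q {p..<q}" using \<open>p < q\<close> by auto
    then have "a q * v N i = - (\<Sum>j=p..<q. a j * v (N - int q + int j) i)"
      using restrict[of "N - int q" i] by (simp add: eq_neg_iff_add_eq_0)
    also have "(\<Sum>j=p..<q. a j * v (N - int q + int j) i)
        = (\<Sum>l=1..q - p. a (q - l) * v (N - int l) i)"
      using \<open>p < q\<close>
      by (intro sum.reindex_bij_witness[of _ "\<lambda>l. q - l" "\<lambda>j. q - j"])
        (auto simp: of_nat_diff algebra_simps)
    finally have "v N i = - (\<Sum>l=1..q - p. a (q - l) * v (N - int l) i) / a q"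
      using pq by (simp add: S_def field_simps)
    then show ?thesis by (simp add: sum_negf sum_divide_distrib)
  qed
  moreover have "q - p \<ge> 1" "- (a (q - (q - p)) / a q) \<noteq> 0"
    using pq \<open>p < q\<close> by (auto simp: S_def)
  ultimately show ?thesis by (intro exI[of _ "q - p"] exI[of _ "\<lambda>l. - (a (q - l) / a q)"]) blast
qed

section \<open>Modified peak-valley sequences as walks in an adjacency relation\<close>

text \<open>The relation whose 0-1 matrix is \<open>E\<close>. It is symmetric, since the valley and
  peak conditions are imposed on both entries.\<close>

definition pv_adj :: "nat \<Rightarrow> nat \<Rightarrow> bool" where
  "pv_adj a b \<longleftrightarrow> (a mod 3 = 1 \<longrightarrow> a < b) \<and> (a mod 3 = 2 \<longrightarrow> b < a) \<and>
     (b mod 3 = 1 \<longrightarrow> b < a) \<and> (b mod 3 = 2 \<longrightarrow> a < b)"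

text \<open>The two-sided condition at an entry splits into one condition on each of the two
  adjacent pairs containing it.\<close>

lemma modified_pv3_iff_successively: "modified_pv3 xs \<longleftrightarrow> successively pv_adj (0 # xs @ [0])"
proof -
  let ?a = "\<lambda>i. (0 # xs @ [0]) ! i"
  \<comment> \<open>The padding zeros have residue 0, so as entries of a pair they impose no
    condition of their own.\<close>
  have ends: "?a 0 = 0" "?a (Suc (length xs)) = 0" by simp_all
  have "successively pv_adj (0 # xs @ [0]) \<longleftrightarrow>
      (\<forall>i\<le>length xs. pv_adj (?a i) (?a (Suc i)))"
    by (simp add: successively_conv_nth less_Suc_eq_le del: nth_Cons_Suc)
  also have "\<dots> \<longleftrightarrow> modified_pv3 xs"
  proof
    assume adj: "\<forall>i\<le>length xs. pv_adj (?a i) (?a (Suc i))"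
    show "modified_pv3 xs"
      unfolding modified_pv3_def Let_def
    proof
      fix i assume "i \<in> {1..length xs}"
      then obtain l where l: "i = Suc l" "l < length xs"
        by (cases i) auto
      show "(?a i mod 3 = 1 \<longrightarrow> ?a (i - 1) > ?a i \<and> ?a i < ?a (i + 1)) \<and>
          (?a i mod 3 = 2 \<longrightarrow> ?a (i - 1) < ?a i \<and> ?a i > ?a (i + 1))"
        using adj[rule_format, of l] adj[rule_format, of "Suc l"] l
        by (simp add: pv_adj_def del: nth_Cons_Suc)
    qed
  next
    assume "modified_pv3 xs"
    then have pv: "(?a i mod 3 = 1 \<longrightarrow> ?a (i - 1) > ?a i \<and> ?a i < ?a (i + 1)) \<and>
          (?a i mod 3 = 2 \<longrightarrow> ?a (i - 1) < ?a i \<and> ?a i > ?a (i + 1))"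
      if "1 \<le> i" "i \<le> length xs" for i
      using that unfolding modified_pv3_def Let_def by auto
    show "\<forall>i\<le>length xs. pv_adj (?a i) (?a (Suc i))"
    proof (intro allI impI)
      fix i assume i: "i \<le> length xs"
      have "(?a i mod 3 = 1 \<longrightarrow> ?a i < ?a (Suc i)) \<and> (?a i mod 3 = 2 \<longrightarrow> ?a (Suc i) < ?a i)"
        using pv[of i] i ends by (cases "i = 0") (simp_all del: nth_Cons_Suc)
      moreover have "(?a (Suc i) mod 3 = 1 \<longrightarrow> ?a (Suc i) < ?a i) \<and>
          (?a (Suc i) mod 3 = 2 \<longrightarrow> ?a i < ?a (Suc i))"
        using pv[of "Suc i"] i ends by (cases "i = length xs") (simp_all del: nth_Cons_Suc)
      ultimately show "pv_adj (?a i) (?a (Suc i))" by (simp add: pv_adj_def)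
    qed
  qed
  finally show ?thesis by simp
qed

text \<open>Entry \<open>i\<close> of \<open>(E diag(V))^n E e_0\<close>, with indices cut off at
  \<open>K\<close> and \<open>e_0\<close> the unit vector at 0.\<close>

fun pv_sum :: "(nat \<Rightarrow> 'f::comm_semiring_1) \<Rightarrow> nat \<Rightarrow> nat \<Rightarrow> nat \<Rightarrow> 'f" where
  "pv_sum V K 0 i = of_bool (pv_adj i 0)"
| "pv_sum V K (Suc n) i = (\<Sum>j\<le>K. of_bool (pv_adj i j) * (V j * pv_sum V K n j))"

text \<open>Splitting off the first entry \<open>j\<close> of the sequence, which then takes the
  place of the left boundary \<open>i\<close>.\<close>

lemma sum_successively_pv_adj:
  "(\<Sum>xs | length xs = n \<and> set xs \<subseteq> {0..K} \<and> successively pv_adj (i # xs @ [0]).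
      prod_list (map V xs)) = pv_sum V K n i"
proof (induction n arbitrary: i)
  case 0
  have "{xs. length xs = 0 \<and> set xs \<subseteq> {0..K} \<and> successively pv_adj (i # xs @ [0])}
      = (if pv_adj i 0 then {[]} else {})" by auto
  then show ?case by simp
next
  case (Suc n)
  let ?S = "\<lambda>n i. {xs. length xs = n \<and> set xs \<subseteq> {0..K} \<and> successively pv_adj (i # xs @ [0])}"
  have fin: "finite (?S n i)" for n i
    by (rule finite_subset[OF _ finite_lists_length_eq[of "{0..K}" n]]) auto
  have S_Suc: "?S (Suc n) i = (\<Union>j\<in>{j\<in>{..K}. pv_adj i j}. (#) j ` ?S n j)"
    by (auto simp: length_Suc_conv image_iff)
  have "(\<Sum>xs\<in>?S (Suc n) i. prod_list (map V xs))
      = (\<Sum>j\<in>{j\<in>{..K}. pv_adj i j}. \<Sum>xs\<in>(#) j ` ?S n j. prod_list (map V xs))"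
    unfolding S_Suc by (rule sum.UNION_disjoint) (auto intro: fin)
  also have "\<dots> = (\<Sum>j\<in>{j\<in>{..K}. pv_adj i j}. V j * pv_sum V K n j)"
    by (intro sum.cong refl, subst sum.reindex)
      (auto simp: Suc.IH[symmetric] sum_distrib_left)
  also have "\<dots> = pv_sum V K (Suc n) i"
    unfolding sum.inter_filter[OF finite_atMost] pv_sum.simps by (rule sum.cong) auto
  finally show ?case .
qed

text \<open>The diagonal of the sign matrix \<open>D\<close>.\<close>

definition pv_sign :: "nat \<Rightarrow> 'f::comm_ring_1" where
  "pv_sign i = (-1) ^ ((i + 1) div 3)"

lemma pv_sign_mod_3:
  "pv_sign (3 * q) = (-1) ^ q" "pv_sign (3 * q + 1) = (-1) ^ q" "pv_sign (3 * q + 2) = - ((-1) ^ q)"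
proof -
  have "(3 * q + 1) div 3 = q" "(3 * q + 1 + 1) div 3 = q" "(3 * q + 2 + 1) div 3 = Suc q"
    by presburger+
  then show "pv_sign (3 * q) = (-1) ^ q" "pv_sign (3 * q + 1) = (-1) ^ q"
      "pv_sign (3 * q + 2) = - ((-1) ^ q)"
    unfolding pv_sign_def by simp_all
qed

lemma residues_mod_3:
  "3 * q mod 3 = (0 :: nat)" "(3 * q + 1) mod 3 = (1 :: nat)" "(3 * q + 2) mod 3 = (2 :: nat)"
  by presburger+

text \<open>The matrix \<open>E\<close> in blocks of size 3: with the residues fixed, each entry
  depends only on how the quotients compare.\<close>

lemma pv_adj_mod_3:
  "pv_adj (3 * q) (3 * s)"
  "pv_adj (3 * q) (3 * s + 1) \<longleftrightarrow> s < q"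
  "pv_adj (3 * q) (3 * s + 2) \<longleftrightarrow> q \<le> s"
  "pv_adj (3 * q + 1) (3 * s) \<longleftrightarrow> q < s"
  "\<not> pv_adj (3 * q + 1) (3 * s + 1)"
  "pv_adj (3 * q + 1) (3 * s + 2) \<longleftrightarrow> q \<le> s"
  "pv_adj (3 * q + 2) (3 * s) \<longleftrightarrow> s \<le> q"
  "pv_adj (3 * q + 2) (3 * s + 1) \<longleftrightarrow> s \<le> q"
  "\<not> pv_adj (3 * q + 2) (3 * s + 2)"
  unfolding pv_adj_def residues_mod_3 by auto

text \<open>Entrywise form of \<open>M D E = - D\<close>; no cutoff at \<open>i = 3k\<close> is needed because the row
  \<open>3k + 1\<close> of \<open>E\<close> vanishes in the columns up to \<open>3k\<close>.\<close>

lemma pv_adj_kernel: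
  "pv_sign (i + 1) * of_bool (pv_adj (i + 1) j)
     + (if i = 0 then 0 else pv_sign (i - 1) * of_bool (pv_adj (i - 1) j))
     - pv_sign i * of_bool (pv_adj i j)
   = - (pv_sign i * of_bool (i = j) :: 'f::comm_ring_1)"
proof -
  define q where "q = i div 3"
  define s where "s = j div 3"
  have j: "j = 3 * s \<or> j = 3 * s + 1 \<or> j = 3 * s + 2"
    unfolding s_def by presburger
  have neq: "3 * q \<noteq> 3 * s + 1" "3 * q \<noteq> 3 * s + 2" "3 * q + 1 \<noteq> 3 * s" "3 * q + 1 \<noteq> 3 * s + 2"
      "3 * q + 2 \<noteq> 3 * s" "3 * q + 2 \<noteq> 3 * s + 1" for q s :: nat
    by presburger+
  have "i = 3 * q \<or> i = 3 * q + 1 \<or> i = 3 * q + 2"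
    unfolding q_def by presburger
  \<comment> \<open>Row 0 has no predecessor. For the other multiples of 3, writing
    \<open>i = 3 * (p + 1)\<close> brings \<open>i - 1\<close> into the form
    \<open>3 * p + 2\<close>.\<close>
  then consider "i = 0" | p where "i = 3 * (p + 1)" | "i = 3 * q + 1" | "i = 3 * q + 2"
    by (cases q) auto
  then show ?thesis
  proof cases
    case 1
    have "pv_sign 0 = (1 :: 'f)" "pv_sign (0 + 1) = (1 :: 'f)"
      using pv_sign_mod_3(1,2)[of 0] by simp_all
    \<comment> \<open>Rows 0 and 1 of \<open>E\<close> differ only in column 0.\<close>
    moreover have "pv_adj (0 + 1) j \<longleftrightarrow> j mod 3 \<noteq> 1 \<and> j \<noteq> 0" "pv_adj 0 j \<longleftrightarrow> j mod 3 \<noteq> 1"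
      unfolding pv_adj_def by presburger+
    ultimately show ?thesis unfolding 1 by simp
  next
    case (2 p)
    have e: "3 * (p + 1) - 1 = 3 * p + 2" by simp
    show ?thesis
      unfolding 2 e using j
      by (elim disjE; simp only: pv_sign_mod_3 pv_adj_mod_3 neq; auto split: split_of_bool)
  next
    case 3
    have e: "3 * q + 1 + 1 = 3 * q + 2" "3 * q + 1 - 1 = 3 * q" by simp_all
    show ?thesis
      unfolding 3 e using j
      by (elim disjE; simp only: pv_sign_mod_3 pv_adj_mod_3 neq; auto split: split_of_bool)
  next
    case 4
    have e: "3 * q + 2 + 1 = 3 * (q + 1)" "3 * q + 2 - 1 = 3 * q + 1" by simp_all
    show ?thesis
      unfolding 4 e using j
      by (elim disjE; simp only: pv_sign_mod_3 pv_adj_mod_3 neq; auto split: split_of_bool)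
  qed
qed

section \<open>Transfer-matrix recursion for bounded Motzkin paths\<close>

text \<open>The end height is left free because removing the last step of a path to height 0 may
  leave a path to height 1.\<close>

definition motzkin_paths_to :: "nat \<Rightarrow> nat \<Rightarrow> nat \<Rightarrow> (int \<times> nat) list set" where
  "motzkin_paths_to K N i = {p. motzkin_path p \<and> hd p = (0, 0) \<and> last p = (int N, i) \<and>
     (\<forall>u\<in>set p. snd u \<le> K)}"

definition mu_to :: "nat \<Rightarrow> (nat \<Rightarrow> 'f) \<Rightarrow> (nat \<Rightarrow> 'f) \<Rightarrow> nat \<Rightarrow> nat \<Rightarrow> 'f::field" where
  "mu_to K b lam N i = (\<Sum>p\<in>motzkin_paths_to K N i. path_weight b lam p)"

lemma motzkin_path_snoc:
  assumes "q \<noteq> []"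
  shows "motzkin_path (q @ [u]) \<longleftrightarrow>
    motzkin_path q \<and> fst u = fst (last q) + 1 \<and> int (snd u) - int (snd (last q)) \<in> {1, 0, -1}"
proof -
  have "motzkin_path p \<longleftrightarrow> p \<noteq> [] \<and> successively (\<lambda>x y. fst y = fst x + 1 \<and>
      int (snd y) - int (snd x) \<in> {1, 0, -1}) p" for p
    by (auto simp: motzkin_path_def successively_conv_nth)
  then show ?thesis using assms by (simp add: successively_append_iff)
qed

lemma path_weight_snoc:
  assumes "q \<noteq> []"
  shows "path_weight b lam (q @ [u]) = path_weight b lam q * step_weight b lam (last q) u"
proof -
  obtain l where l: "length q = Suc l" using assms by (cases q) auto
  have "(\<Prod>j<l. step_weight b lam ((q @ [u]) ! j) ((q @ [u]) ! Suc j))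
      = (\<Prod>j<l. step_weight b lam (q ! j) (q ! Suc j))"
    by (intro prod.cong) (auto simp: nth_append l)
  then show ?thesis
    using assms by (simp add: path_weight_def l nth_append last_conv_nth)
qed

lemma motzkin_paths_to_0: "motzkin_paths_to K 0 i = (if i = 0 then {[(0, 0)]} else {})"
proof -
  have "p \<in> {[(0, 0)]} \<and> i = 0" if "p \<in> motzkin_paths_to K 0 i" for p
  proof -
    have p: "motzkin_path p" "hd p = (0, 0)" "last p = (0, i)" "p \<noteq> []"
      using that by (auto simp: motzkin_paths_to_def motzkin_path_def)
    then have "int (length p - 1) = 0"
      using motzkin_path_fst[of p "length p - 1"] by (simp add: last_conv_nth)
    then have "length p = 1" using p(4) by (cases p) auto
    then show ?thesis using p by (auto simp: length_Suc_conv)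
  qed
  moreover have "[(0, 0)] \<in> motzkin_paths_to K 0 0"
    by (simp add: motzkin_paths_to_def motzkin_path_def)
  ultimately show ?thesis by (cases "i = 0") (simp_all only: if_True if_False, blast+)
qed

lemma motzkin_paths_to_outside: "i > K \<Longrightarrow> motzkin_paths_to K N i = {}"
proof -
  assume "i > K"
  have False if "p \<in> motzkin_paths_to K N i" for p
  proof -
    have "p \<noteq> []" "last p = (int N, i)" "\<forall>u\<in>set p. snd u \<le> K"
      using that unfolding motzkin_paths_to_def motzkin_path_def by blast+
    then have "i \<le> K" using last_in_set[of p] by fastforce
    with \<open>i > K\<close> show False by simp
  qed
  then show ?thesis by blast
qed

text \<open>Decomposition by the last step. The index \<open>j = K + 1\<close>, which occurs for
  \<open>i = K\<close>, contributes the empty set.\<close>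

lemma motzkin_paths_to_Suc:
  assumes "i \<le> K"
  shows "motzkin_paths_to K (Suc N) i =
    (\<Union>j\<in>{j. i \<le> Suc j \<and> j \<le> Suc i}. (\<lambda>q. q @ [(int (Suc N), i)]) ` motzkin_paths_to K N j)"
    (is "?L = ?R")
proof (intro equalityI subsetI)
  fix p assume "p \<in> ?L"
  then have p: "motzkin_path p" "hd p = (0, 0)" "last p = (int (Suc N), i)" "p \<noteq> []"
      "\<forall>u\<in>set p. snd u \<le> K"
    by (auto simp: motzkin_paths_to_def motzkin_path_def)
  define q where "q = butlast p"
  have snoc: "p = q @ [(int (Suc N), i)]"
    using p(3,4) by (metis q_def append_butlast_last_id)
  have "q \<noteq> []" using snoc p(2) by auto
  moreover obtain x j where xj: "last q = (x, j)" by fastforce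
  ultimately have "q \<in> motzkin_paths_to K N j" "i \<le> Suc j \<and> j \<le> Suc i"
    using p(1,2,5) unfolding snoc by (auto simp: motzkin_path_snoc motzkin_paths_to_def)
  then show "p \<in> ?R" using snoc by blast
next
  fix p assume "p \<in> ?R"
  then obtain j q where j: "i \<le> Suc j" "j \<le> Suc i" and q: "q \<in> motzkin_paths_to K N j"
      and p: "p = q @ [(int (Suc N), i)]" by blast
  have "q \<noteq> []" using q by (auto simp: motzkin_paths_to_def motzkin_path_def)
  moreover have "int i - int j \<in> {1, 0, -1}" using j by auto
  ultimately show "p \<in> ?L"
    using q assms unfolding p by (auto simp: motzkin_paths_to_def motzkin_path_snoc)
qed

lemma finite_motzkin_paths_to: "finite (motzkin_paths_to K N i)"
proof (induction N arbitrary: i)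
  case (Suc N)
  show ?case
  proof (cases "i \<le> K")
    case True
    have "finite {j. i \<le> Suc j \<and> j \<le> Suc i}" by (rule finite_subset[of _ "{..Suc i}"]) auto
    then show ?thesis unfolding motzkin_paths_to_Suc[OF True] using Suc by blast
  qed (simp add: motzkin_paths_to_outside)
qed (simp add: motzkin_paths_to_0)

lemma mu_to_0: "mu_to K b lam 0 i = of_bool (i = 0)"
  by (simp add: mu_to_def motzkin_paths_to_0 path_weight_def)

lemma mu_to_outside: "i > K \<Longrightarrow> mu_to K b lam N i = 0"
  by (simp add: mu_to_def motzkin_paths_to_outside)

text \<open>The three terms come from a last step that is horizontal, up or down. At
  \<open>i = K\<close> the last one vanishes by \<open>mu_to_outside\<close>.\<close>

lemma mu_to_Suc:
  assumes "i \<le> K"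
  shows "mu_to K b lam (Suc N) i = b i * mu_to K b lam N i
    + (if i = 0 then 0 else mu_to K b lam N (i - 1)) + lam (i + 1) * mu_to K b lam N (i + 1)"
proof -
  let ?S = "{j. i \<le> Suc j \<and> j \<le> Suc i}" and ?u = "(int (Suc N), i)"
  let ?w = "\<lambda>j. step_weight b lam (int N, j) ?u"
  have S: "?S = (if i = 0 then {i, i + 1} else {i - 1, i, i + 1})" by auto
  have sub: "(\<Sum>p\<in>(\<lambda>q. q @ [?u]) ` motzkin_paths_to K N j. path_weight b lam p)
      = mu_to K b lam N j * ?w j" for j
  proof -
    have "(\<Sum>p\<in>(\<lambda>q. q @ [?u]) ` motzkin_paths_to K N j. path_weight b lam p)
        = (\<Sum>q\<in>motzkin_paths_to K N j. path_weight b lam (q @ [?u]))"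
      by (subst sum.reindex) (auto simp: inj_on_def)
    also have "\<dots> = (\<Sum>q\<in>motzkin_paths_to K N j. path_weight b lam q * ?w j)"
      by (intro sum.cong refl, subst path_weight_snoc)
        (auto simp: motzkin_paths_to_def motzkin_path_def)
    finally show ?thesis by (simp add: mu_to_def sum_distrib_right)
  qed
  have "mu_to K b lam (Suc N) i
      = (\<Sum>j\<in>?S. \<Sum>p\<in>(\<lambda>q. q @ [?u]) ` motzkin_paths_to K N j. path_weight b lam p)"
    unfolding mu_to_def motzkin_paths_to_Suc[OF assms]
  proof (rule sum.UNION_disjoint)
    show "finite ?S" unfolding S by simp
  qed (auto simp: finite_motzkin_paths_to, auto simp: motzkin_paths_to_def)
  also have "\<dots> = (\<Sum>j\<in>?S. mu_to K b lam N j * ?w j)"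
    by (simp only: sub)
  also have "\<dots> = b i * mu_to K b lam N i
    + (if i = 0 then 0 else mu_to K b lam N (i - 1)) + lam (i + 1) * mu_to K b lam N (i + 1)"
    unfolding S by (cases i) (simp_all add: step_weight_def)
  finally show ?thesis .
qed

section \<open>The tridiagonal matrix and its inverse\<close>

text \<open>The matrix \<open>diag(V)^-1 M\<close> acting on functions that vanish above
  \<open>K\<close>; for these the value \<open>w (K + 1)\<close> read in the last row is 0.\<close>

definition tridiag :: "nat \<Rightarrow> (nat \<Rightarrow> 'f) \<Rightarrow> (nat \<Rightarrow> 'f) \<Rightarrow> nat \<Rightarrow> 'f::field" where
  "tridiag K V w i =
     (if i \<le> K then (w (i + 1) + (if i = 0 then 0 else w (i - 1)) - w i) / V i else 0)"

lemma tridiag_sum: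
  "tridiag K V (\<lambda>i. \<Sum>j\<in>J. a j * w j i) = (\<lambda>i. \<Sum>j\<in>J. a j * tridiag K V (w j) i)"
proof
  fix i
  show "tridiag K V (\<lambda>i. \<Sum>j\<in>J. a j * w j i) i = (\<Sum>j\<in>J. a j * tridiag K V (w j) i)"
    unfolding tridiag_def
    by (cases "i = 0"; cases "i \<le> K";
      simp add: sum_divide_distrib sum.distrib sum_subtractf distrib_left right_diff_distrib
        add_divide_distrib diff_divide_distrib)
qed

text \<open>A kernel vector satisfies \<open>w (i + 1) = w i - w (i - 1)\<close>, so it runs through
  \<open>w 0\<close> times 1, 1, 0, -1, -1, 0 with period 6. The value at \<open>3 * k + 1\<close>
  is \<open>w 0\<close> up to sign, and the support condition makes it 0.\<close>

lemma tridiag_inj: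
  fixes V w :: "nat \<Rightarrow> 'f::field"
  assumes V: "\<And>i. V i \<noteq> 0" and supp: "\<And>i. i > 3 * k \<Longrightarrow> w i = 0"
    and zero: "tridiag (3 * k) V w = (\<lambda>_. 0)"
  shows "w = (\<lambda>_. 0)"
proof -
  have rec: "w (Suc i) = w i - (if i = 0 then 0 else w (i - 1))" if "i \<le> 3 * k" for i
    using fun_cong[OF zero, of i] that V[of i] by (simp add: tridiag_def eq_diff_eq split: if_splits)
  have "w (3 * q) = (-1) ^ q * w 0 \<and> w (3 * q + 1) = (-1) ^ q * w 0" if "q \<le> k" for q
    using that
  proof (induction q)
    case 0
    then show ?case using rec[of 0] by simp
  next
    case (Suc q)
    define m where "m = 3 * q"
    have m: "3 * Suc q = Suc (Suc (Suc m))" "3 * Suc q + 1 = Suc (Suc (Suc (Suc m)))"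
      by (simp_all add: m_def)
    have IH: "w m = (-1) ^ q * w 0" "w (Suc m) = (-1) ^ q * w 0"
      using Suc by (simp_all add: m_def)
    have "Suc (Suc (Suc m)) \<le> 3 * k" using Suc.prems by (simp add: m_def)
    then show ?case
      unfolding m using rec[of "Suc m"] rec[of "Suc (Suc m)"] rec[of "Suc (Suc (Suc m))"] IH
      by simp
  qed
  from this[of k] have "w 0 = 0" using supp[of "3 * k + 1"] by simp
  have "w i = 0 \<and> w (Suc i) = 0" if "i \<le> 3 * k" for i
    using that
  proof (induction i)
    case 0
    then show ?case using rec[of 0] \<open>w 0 = 0\<close> by simp
  next
    case (Suc i)
    then show ?case using rec[of "Suc i"] by simp
  qed
  then show ?thesis using supp by (metis not_le)
qed

text \<open>Here \<open>w = c D E x\<close>, cut off above \<open>3 * k\<close>, and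
  \<open>M D E = -D\<close> is applied column by column.\<close>

lemma tridiag_inverse:
  fixes V x :: "nat \<Rightarrow> 'f::field" and c :: 'f and k :: nat
  defines "w \<equiv> \<lambda>i. if i \<le> 3 * k then c * pv_sign i * (\<Sum>j\<le>3 * k. of_bool (pv_adj i j) * x j) else 0"
  assumes "i \<le> 3 * k"
  shows "tridiag (3 * k) V w i = - c * pv_sign i * x i / V i"
proof -
  \<comment> \<open>The sum formula also covers \<open>i = 3 * k + 1\<close>, which the last row
    reads: there the cutoff gives 0, and so does \<open>E\<close>, since a valley at
    \<open>3 * k + 1\<close> needs a larger neighbour.\<close>
  have w: "w i = (\<Sum>j\<le>3 * k. c * x j * (pv_sign i * of_bool (pv_adj i j)))" if "i \<le> 3 * k + 1" for i
  proof (cases "i \<le> 3 * k")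
    case False
    with that have i: "i = 3 * k + 1" by simp
    then have "\<not> pv_adj i j" if "j \<le> 3 * k" for j
      using that unfolding pv_adj_def i by simp
    then show ?thesis using False by (simp add: w_def)
  next
    case True
    have "c * pv_sign i * (\<Sum>j\<le>3 * k. of_bool (pv_adj i j) * x j)
        = (\<Sum>j\<le>3 * k. c * x j * (pv_sign i * of_bool (pv_adj i j)))"
      unfolding sum_distrib_left by (intro sum.cong refl) (simp only: mult_ac)
    with True show ?thesis by (simp only: w_def if_True)
  qed
  have "w (i + 1) + (if i = 0 then 0 else w (i - 1)) - w i
      = (\<Sum>j\<le>3 * k. c * x j * (pv_sign (i + 1) * of_bool (pv_adj (i + 1) j)
         + (if i = 0 then 0 else pv_sign (i - 1) * of_bool (pv_adj (i - 1) j))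
         - pv_sign i * of_bool (pv_adj i j)))"
    using assms(2)
    by (cases "i = 0") (simp_all add: w sum.distrib sum_subtractf distrib_left right_diff_distrib)
  also have "\<dots> = (\<Sum>j\<le>3 * k. if i = j then - (c * x i * pv_sign i) else 0)"
    unfolding pv_adj_kernel by (intro sum.cong) auto
  also have "\<dots> = - c * pv_sign i * x i"
    using assms(2) by simp
  finally show ?thesis using assms(2) by (simp add: tridiag_def)
qed

section \<open>The two-sided orbit of the tridiagonal matrix\<close>

text \<open>The factor \<open>\<Prod>j<i. V (Suc j)\<close> conjugates the transfer matrix of Motzkin paths to
  \<^const>\<open>tridiag\<close>.\<close>

definition scaled_mu :: "nat \<Rightarrow> (nat \<Rightarrow> 'f) \<Rightarrow> (nat \<Rightarrow> 'f) \<Rightarrow> (nat \<Rightarrow> 'f) \<Rightarrow> int \<Rightarrow> nat \<Rightarrow> 'f::field" where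
  "scaled_mu K V b lam N i =
     (if N \<ge> 0 then mu_to K b lam (nat N) i / (\<Prod>j<i. V (Suc j))
      else if i \<le> K then (-1) ^ nat (- N) * V 0 * pv_sign i * pv_sum V K (nat (- N) - 1) i else 0)"

text \<open>The inverse matrix is \<open>- D E D diag(V)\<close>. As \<open>D\<close> commutes with
  \<open>diag(V)\<close>, squares to 1 and fixes \<open>e_0\<close>, its \<open>n\<close>-th power
  sends \<open>e_0\<close> to \<open>(-1)^n V_0 D (E diag(V))^(n-1) E e_0\<close>, the branch of
  \<open>scaled_mu\<close> at negative indices.\<close>

lemma scaled_mu_step:
  fixes V b lam :: "nat \<Rightarrow> 'f::field"
  assumes V: "\<And>i. V i \<noteq> 0" and b: "\<And>i. b i = - inverse (V i)"
    and lam: "\<And>i. i \<ge> 1 \<Longrightarrow> lam i = inverse (V i) * inverse (V (i - 1))"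
  shows "scaled_mu (3 * k) V b lam (N + 1) = tridiag (3 * k) V (scaled_mu (3 * k) V b lam N)"
    (is "?v (N + 1) = _")
proof
  fix i
  show "?v (N + 1) i = tridiag (3 * k) V (?v N) i"
  proof (cases "i \<le> 3 * k")
    case False
    then show ?thesis by (simp add: scaled_mu_def tridiag_def mu_to_outside)
  next
    case i: True
    \<comment> \<open>Path recursion, passage from -1 to 0, and removal of one factor of
      \<open>pv_sum\<close>, whose length \<open>- N - 1 = n + 1\<close> is positive.\<close>
    consider "N \<ge> 0" | "N = -1" | n where "N = - int n - 2"
    proof -
      have "N \<ge> 0 \<or> N = -1 \<or> N = - int (nat (- N - 2)) - 2" by linarith
      then show thesis using that by blast
    qed
    then show ?thesis
    proof cases
      case 1
      define G where "G = mu_to (3 * k) b lam (nat N)"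
      have "mu_to (3 * k) b lam (Suc (nat N)) i
          = - G i / V i + (if i = 0 then 0 else G (i - 1)) + G (i + 1) / (V (i + 1) * V i)"
        using mu_to_Suc[OF i, of b lam "nat N"] b[of i] lam[of "i + 1"]
        by (simp add: G_def field_simps)
      moreover have "nat (N + 1) = Suc (nat N)" using 1 by simp
      ultimately have lhs: "?v (N + 1) i = (- G i / V i + (if i = 0 then 0 else G (i - 1))
          + G (i + 1) / (V (i + 1) * V i)) / (\<Prod>j<i. V (Suc j))"
        using 1 by (simp add: scaled_mu_def)
      have rhs: "?v N = (\<lambda>i. G i / (\<Prod>j<i. V (Suc j)))"
        using 1 by (auto simp: scaled_mu_def G_def)
      show ?thesis
      proof (cases i)
        case 0
        then show ?thesis unfolding lhs rhs using V by (simp add: tridiag_def field_simps)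
      next
        case (Suc m)
        \<comment> \<open>The scaling factors at \<open>m\<close>, \<open>m + 1\<close>,
          \<open>m + 2\<close> are \<open>Q\<close>, \<open>Q * V (m + 1)\<close> and
          \<open>Q * V (m + 1) * V (m + 2)\<close>, so both off-diagonal entries of row
          \<open>i = m + 1\<close> become \<open>1 / V i\<close>.\<close>
        define Q where "Q = (\<Prod>j<m. V (Suc j))"
        have Q: "Q \<noteq> 0" using V by (simp add: Q_def)
        show ?thesis
          unfolding lhs rhs using V i Q
          by (simp add: Suc tridiag_def Q_def[symmetric] field_simps)
      qed
    next
      case 2
      \<comment> \<open>At -1 the vector is \<open>- V_0 D E e_0\<close>, with \<open>E e_0\<close>
        written as a sum against the indicator of 0.\<close>
      have "?v N = (\<lambda>i. if i \<le> 3 * k then (- V 0) * pv_sign i *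
          (\<Sum>j\<le>3 * k. of_bool (pv_adj i j) * of_bool (j = 0)) else 0)"
        by (auto simp: scaled_mu_def 2)
      then have "tridiag (3 * k) V (?v N) i = V 0 * pv_sign i * of_bool (i = 0) / V i"
        using tridiag_inverse[OF i, of V "- V 0" "\<lambda>j. of_bool (j = 0)"] by simp
      also have "\<dots> = ?v (N + 1) i"
        using V[of 0] by (cases "i = 0") (simp_all add: 2 scaled_mu_def mu_to_0 pv_sign_def)
      finally show ?thesis by simp
    next
      case (3 n)
      have nat: "nat (- N) = n + 2" "nat (- (N + 1)) = n + 1" using 3 by simp_all
      have "?v N = (\<lambda>i. if i \<le> 3 * k then ((-1) ^ n * V 0) * pv_sign i *
          (\<Sum>j\<le>3 * k. of_bool (pv_adj i j) * (V j * pv_sum V (3 * k) n j)) else 0)"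
        using 3 unfolding scaled_mu_def nat by auto
      then have "tridiag (3 * k) V (?v N) i
          = - ((-1) ^ n * V 0) * pv_sign i * (V i * pv_sum V (3 * k) n i) / V i"
        using tridiag_inverse[OF i, of V "(-1) ^ n * V 0" "\<lambda>j. V j * pv_sum V (3 * k) n j"]
        by (simp only:)
      also have "\<dots> = ?v (N + 1) i"
        using 3 i V[of i] unfolding scaled_mu_def nat by simp
      finally show ?thesis by simp
    qed
  qed
qed

text \<open>The scaling factor at height 0 is the empty product, so entry 0 of the orbit is
  \<open>mu\<close> at nonnegative indices, and the recurrence of the whole orbit restricts to that
  entry.\<close>

lemma scaled_mu_rec_extension:
  fixes V b lam :: "nat \<Rightarrow> 'f::field"
  assumes V: "\<And>i. V i \<noteq> 0" and b: "\<And>i. b i = - inverse (V i)"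
    and lam: "\<And>i. i \<ge> 1 \<Longrightarrow> lam i = inverse (V i) * inverse (V (i - 1))"
  shows "rec_extension (mu (3 * k) b lam) (\<lambda>N. scaled_mu (3 * k) V b lam N 0)"
proof -
  let ?v = "scaled_mu (3 * k) V b lam"
  have at0: "?v (int N) 0 = mu (3 * k) b lam N" for N
    by (simp add: scaled_mu_def mu_to_def mu_def motzkin_paths_to_def motzkin_paths_def)
  have "\<exists>d c. d \<ge> 1 \<and> c d \<noteq> 0 \<and> (\<forall>N i. ?v N i = (\<Sum>l=1..d. c l * ?v (N - int l) i))"
  proof (rule linear_orbit_recurrence[where m = "3 * k + 1" and T = "tridiag (3 * k) V"])
    show "?v (N + 1) = tridiag (3 * k) V (?v N)" for N
      using assms by (rule scaled_mu_step)
    show "?v N i = 0" if "i \<ge> 3 * k + 1" for N i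
      using that by (simp add: scaled_mu_def mu_to_outside)
    show "w = (\<lambda>_. 0)" if "\<And>i. i \<ge> 3 * k + 1 \<Longrightarrow> w i = 0" "tridiag (3 * k) V w = (\<lambda>_. 0)" for w
      using V that by (intro tridiag_inj[of V k w]) auto
    have "?v 0 0 = 1" by (simp add: scaled_mu_def mu_to_0)
    then show "?v 0 \<noteq> (\<lambda>_. 0)" by auto
  qed (rule tridiag_sum)
  then obtain d c where dc: "d \<ge> 1" "c d \<noteq> 0"
      and rec: "\<And>N i. ?v N i = (\<Sum>l=1..d. c l * ?v (N - int l) i)"
    by blast
  have "mu (3 * k) b lam N = (\<Sum>l=1..d. c l * mu (3 * k) b lam (N - l))" if "N \<ge> d" for N
    using rec[of "int N" 0] that by (simp add: at0[symmetric] of_nat_diff)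
  then show ?thesis
    unfolding rec_extension_def using at0 dc rec by blast
qed

section \<open>Specialization to indeterminates\<close>

lemma indet_nonzero: "indet i \<noteq> (0 :: 'a::idom ratfun)"
proof -
  have "Poly_Mapping.lookup (Poly_Mapping.single m (1 :: 'a)) m \<noteq> 0" for m :: "nat \<Rightarrow>\<^sub>0 nat"
    by simp
  then have "Poly_Mapping.single m (1 :: 'a) \<noteq> 0" for m :: "nat \<Rightarrow>\<^sub>0 nat"
    by (metis lookup_zero)
  then show ?thesis by (simp add: indet_def Zero_fract_def eq_fract)
qed

theorem theorem4p5:
  fixes b lam :: "nat \<Rightarrow> 'a::idom ratfun" and k n :: nat
  assumes b: "\<And>i. b i = - inverse (indet i)"
    and lam: "\<And>i. i \<ge> 1 \<Longrightarrow> lam i = inverse (indet i) * inverse (indet (i - 1))"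
    and k: "k \<ge> 1" and n: "n \<ge> 1"
  shows "(\<exists>g. rec_extension (mu (3 * k) b lam) g) \<and>
    rec_ext (mu (3 * k) b lam) (- int n) =
      (-1) ^ n * indet 0 * (\<Sum>\<pi>\<in>modified_PV3 (3 * k) (n - 1). seq_wt \<pi>)"
proof
  have ext: "rec_extension (mu (3 * k) b lam) (\<lambda>N. scaled_mu (3 * k) indet b lam N 0)"
    using indet_nonzero b lam by (rule scaled_mu_rec_extension)
  then show "\<exists>g. rec_extension (mu (3 * k) b lam) g" by blast
  have "(\<Sum>\<pi>\<in>modified_PV3 (3 * k) (n - 1). seq_wt \<pi> :: 'a ratfun) = pv_sum indet (3 * k) (n - 1) 0"
    unfolding sum_successively_pv_adj[symmetric] modified_PV3_def seq_wt_def
      modified_pv3_iff_successively ..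
  then show "rec_ext (mu (3 * k) b lam) (- int n) =
      (-1) ^ n * indet 0 * (\<Sum>\<pi>\<in>modified_PV3 (3 * k) (n - 1). seq_wt \<pi>)"
    using n unfolding rec_ext_eq[OF ext] by (simp add: scaled_mu_def pv_sign_def)
qed

end
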